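(* Let $n\ge3$ and $l\ge5$. Let $H$ be a connected linear $3$-graph on $n$ vertices. If $H$ is Berge-$C_l$-free, then $$\rho(H)\le\sqrt{\frac{(6l-13)(n-1)}{4}}.$$
   Context: A $k$-graph ($k$-uniform hypergraph) $H$ consists of a finite vertex set $V(H)$ and a set $E(H)$ of $k$-element subsets of $V(H)$ (edges). $H$ is linear if any two distinct edges share at most one vertex. Two vertices are adjacent if some edge contains both; $H$ is connected if the graph on $V(H)$ with this adjacency relation is connected. For $V(H)=\{v_1,\dots,v_n\}$, the adjacency tensor $\mathcal{A}(H)=(a_{i_1\dots i_k})$ is the order-$k$, dimension-$n$ tensor with $a_{i_1\dots i_k}=\frac{1}{(k-1)!}$ if $\{v_{i_1},\dots,v_{i_k}\}\in E(H)$ and $0$ otherwise. A number $\lambda\in\mathbb{C}$ is an eigenvalue of an order-$k$ dimension-$n$ tensor $\mathcal{A}=(a_{i_1\dots i_k})$ if there is a nonzero $\mathbf{x}\in\mathbb{C}^n$ with $\sum_{i_2,\dots,i_k=1}^n a_{i i_2\dots i_k}x_{i_2}\cdots x_{i_k}=\lambda x_i^{k-1}$ for all $i$; the spectral radius is the largest modulus of an eigenvalue. $\rho(H)$ denotes the spectral radius of $\mathcal{A}(H)$. For a graph $G$, a hypergraph $F$ is a Berge-$G$ if there is a bijection $\varphi:E(G)\to E(F)$ with $e\subseteq\varphi(e)$ for every $e\in E(G)$. $H$ is Berge-$G$-free if no subhypergraph of $H$ is a Berge-$G$. $C_l$ denotes the cycle of length $l$. *)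

theory Defs
  imports Complex_Main
begin

record 'a hypergraph =
  verts :: "'a set"
  edges :: "'a set set"

definition k_graph :: "nat \<Rightarrow> 'a hypergraph \<Rightarrow> bool" where
  "k_graph k H \<longleftrightarrow> finite (verts H) \<and> (\<forall>e\<in>edges H. e \<subseteq> verts H \<and> card e = k)"

definition linear_hypergraph :: "'a hypergraph \<Rightarrow> bool" where
  "linear_hypergraph H \<longleftrightarrow> (\<forall>e\<in>edges H. \<forall>f\<in>edges H. e \<noteq> f \<longrightarrow> card (e \<inter> f) \<le> 1)"

definition adjacent :: "'a hypergraph \<Rightarrow> 'a \<Rightarrow> 'a \<Rightarrow> bool" where
  "adjacent H u v \<longleftrightarrow> u \<noteq> v \<and> (\<exists>e\<in>edges H. u \<in> e \<and> v \<in> e)"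

definition connected_hypergraph :: "'a hypergraph \<Rightarrow> bool" where
  "connected_hypergraph H \<longleftrightarrow> (\<forall>u\<in>verts H. \<forall>v\<in>verts H. (adjacent H)\<^sup>*\<^sup>* u v)"

text \<open>A tensor of order \<open>k\<close> whose indices range over a finite set \<open>I\<close> (instead of \<open>{1..n}\<close>)
  is a function on lists; only its values on lists of length \<open>k\<close> over \<open>I\<close> matter. Likewise only
  the values of a vector on \<open>I\<close> matter.\<close>

definition tensor_eigenvalue ::
    "nat \<Rightarrow> 'i set \<Rightarrow> ('i list \<Rightarrow> complex) \<Rightarrow> complex \<Rightarrow> bool" where
  "tensor_eigenvalue k I A \<mu> \<longleftrightarrow>
     (\<exists>x :: 'i \<Rightarrow> complex. (\<exists>i\<in>I. x i \<noteq> 0) \<and>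
       (\<forall>i\<in>I. (\<Sum>js | set js \<subseteq> I \<and> length js = k - 1. A (i # js) * prod_list (map x js))
                = \<mu> * x i ^ (k - 1)))"

text \<open>For \<open>k \<ge> 2\<close> and finite nonempty \<open>I\<close> the eigenvalues are the finitely many roots of
  the characteristic polynomial of the tensor (and there is at least one),
  so this supremum is a maximum.\<close>

definition tensor_spectral_radius :: "nat \<Rightarrow> 'i set \<Rightarrow> ('i list \<Rightarrow> complex) \<Rightarrow> real" where
  "tensor_spectral_radius k I A = Sup {cmod \<mu> | \<mu>. tensor_eigenvalue k I A \<mu>}"

text \<open>Vertices index their own coordinates, so no enumeration of the vertex set is chosen.\<close>

definition adjacency_tensor :: "nat \<Rightarrow> 'a hypergraph \<Rightarrow> 'a list \<Rightarrow> complex" where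
  "adjacency_tensor k H vs = (if set vs \<in> edges H then 1 / fact (k - 1) else 0)"

definition spectral_radius :: "nat \<Rightarrow> 'a hypergraph \<Rightarrow> real" where
  "spectral_radius k H = tensor_spectral_radius k (verts H) (adjacency_tensor k H)"

definition subhypergraph :: "'a hypergraph \<Rightarrow> 'a hypergraph \<Rightarrow> bool" where
  "subhypergraph F H \<longleftrightarrow>
     verts F \<subseteq> verts H \<and> edges F \<subseteq> edges H \<and> (\<forall>e\<in>edges F. e \<subseteq> verts F)"

text \<open>Graphs are 2-graphs. The graph \<open>G\<close> is only meant up to isomorphism: the injection \<open>f\<close>
  places a copy of \<open>G\<close> on vertices of \<open>F\<close>, and the condition \<open>e \<subseteq> \<phi> e\<close> is required
  of that copy.\<close>

definition berge :: "'b hypergraph \<Rightarrow> 'a hypergraph \<Rightarrow> bool" where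
  "berge G F \<longleftrightarrow>
     (\<exists>f \<phi>. inj_on f (verts G) \<and> f ` verts G \<subseteq> verts F \<and>
       bij_betw \<phi> (edges G) (edges F) \<and> (\<forall>e\<in>edges G. f ` e \<subseteq> \<phi> e))"

definition berge_free :: "'b hypergraph \<Rightarrow> 'a hypergraph \<Rightarrow> bool" where
  "berge_free G H \<longleftrightarrow> \<not> (\<exists>F. subhypergraph F H \<and> berge G F)"

definition cycle_graph :: "nat \<Rightarrow> nat hypergraph" where
  "cycle_graph l = \<lparr>verts = {..<l}, edges = (\<lambda>i. {i, (i + 1) mod l}) ` {..<l}\<rparr>"

end

theory Submission
  imports Defs
begin

text \<open>Let \<open>u\<close> be a vertex where an eigenvector for \<open>\<mu>\<close> has maximal modulus, and let \<open>N\<close> be its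
  neighbourhood. Applying the eigenvalue equation first at \<open>u\<close> (with AM-GM on each edge) and then
  at the vertices of \<open>N\<close> gives \<open>2 |\<mu>|\<^sup>2 \<le> (\<Sum>v\<in>N. deg v) = (\<Sum>e. |e \<inter> N|)\<close>. The edges through
  \<open>u\<close> contribute \<open>|N|\<close>. A Berge path of length \<open>l - 2\<close> that avoids \<open>u\<close> and joins two vertices of
  \<open>N\<close> in different edges at \<open>u\<close> closes up to a Berge-\<open>C\<^sub>l\<close>, and such a path can be built greedily
  in a subfamily of large minimum degree: along vertices outside \<open>N\<close> if there are many edges with
  \<open>|e \<inter> N| = 1\<close>, and inside \<open>N\<close> if the edges with \<open>|e \<inter> N| \<ge> 2\<close> have large total weight.
  Hence the edges avoiding \<open>u\<close> contribute at most \<open>(3l - 8)(n - 1)\<close>.\<close>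

section \<open>Berge paths in linear families\<close>

text \<open>Linearity in terms of points instead of \<open>card (e \<inter> f)\<close>, and for a
  bare family of edges: no finiteness enters, and the property passes to the subfamilies chosen
  later.\<close>

definition linear_family :: "'a set set \<Rightarrow> bool" where
  "linear_family F \<longleftrightarrow>
     (\<forall>e\<in>F. \<forall>f\<in>F. \<forall>x y. x \<noteq> y \<longrightarrow> {x, y} \<subseteq> e \<inter> f \<longrightarrow> e = f)"

text \<open>Paths grow at the front: \<open>hd ps\<close> is the moving end and
  \<open>last ps\<close> the fixed one. An edge may contain further vertices of the path besides the
  two that it joins.\<close>

definition berge_path :: "'a set set \<Rightarrow> 'a list \<Rightarrow> 'a set list \<Rightarrow> bool" where
  "berge_path F ps es \<longleftrightarrow>
     length ps = Suc (length es) \<and> distinct ps \<and> distinct es \<and> set es \<subseteq> F \<and>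
     (\<forall>i<length es. ps ! i \<in> es ! i \<and> ps ! Suc i \<in> es ! i)"

lemma linear_familyD:
  "linear_family F \<Longrightarrow> e \<in> F \<Longrightarrow> f \<in> F \<Longrightarrow> x \<noteq> y \<Longrightarrow> x \<in> e \<Longrightarrow> y \<in> e \<Longrightarrow> x \<in> f \<Longrightarrow> y \<in> f \<Longrightarrow> e = f"
  unfolding linear_family_def by blast

lemma linear_family_subset: "linear_family F \<Longrightarrow> G \<subseteq> F \<Longrightarrow> linear_family G"
  unfolding linear_family_def by blast

lemma linear_family_edges:
  assumes "k_graph k H" "linear_hypergraph H"
  shows "linear_family (edges H)"
  unfolding linear_family_def
proof (intro ballI allI impI)
  fix e f and x y :: 'a
  assume ef: "e \<in> edges H" "f \<in> edges H" and xy: "x \<noteq> y" "{x, y} \<subseteq> e \<inter> f"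
  have "finite e"
    using assms(1) ef(1) finite_subset unfolding k_graph_def by blast
  then have "card {x, y} \<le> card (e \<inter> f)"
    using xy(2) by (intro card_mono) auto
  then show "e = f"
    using assms(2) ef xy(1) unfolding linear_hypergraph_def by fastforce
qed

lemma berge_path_Cons:
  assumes "berge_path F (q # ps) es" "e \<in> F" "e \<notin> set es" "q \<in> e" "y \<in> e" "y \<notin> set (q # ps)"
  shows "berge_path F (y # q # ps) (e # es)"
proof -
  have "(y # q # ps) ! i \<in> (e # es) ! i \<and> (y # q # ps) ! Suc i \<in> (e # es) ! i"
    if "i < length (e # es)" for i
    using assms that unfolding berge_path_def by (cases i) auto
  then show ?thesis
    using assms unfolding berge_path_def by simp
qed

text \<open>The later of the two vertices joined by a used edge lies in the tail \<open>ps\<close>.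
  Hence an edge disjoint from the tail is automatically new.\<close>

lemma berge_path_edge_meets:
  assumes "berge_path F (q # ps) es" "e \<in> set es"
  shows "e \<inter> set ps \<noteq> {}"
proof -
  obtain i where "i < length es" "e = es ! i"
    using assms(2) by (metis in_set_conv_nth)
  then show ?thesis
    using assms(1) unfolding berge_path_def by (auto simp: disjoint_iff)
qed

text \<open>By linearity an edge through \<open>q\<close> is determined by any one of its points in
  \<open>B\<close>, so choosing such a point for each edge is injective.\<close>

lemma card_edges_meeting_le:
  assumes "linear_family F" "finite B" "q \<notin> B"
  shows "card {e\<in>F. q \<in> e \<and> e \<inter> B \<noteq> {}} \<le> card B"
proof -
  let ?M = "{e\<in>F. q \<in> e \<and> e \<inter> B \<noteq> {}}"
  have "\<forall>e\<in>?M. \<exists>y. y \<in> e \<inter> B"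
    by blast
  then obtain f where f: "\<forall>e\<in>?M. f e \<in> e \<inter> B"
    by (rule bchoice[THEN exE])
  have "inj_on f ?M"
  proof (rule inj_onI)
    fix d e assume de: "d \<in> ?M" "e \<in> ?M" "f d = f e"
    then show "d = e"
      using bspec[OF f de(1)] bspec[OF f de(2)] assms(3) linear_familyD[OF assms(1), of d e q "f d"] by auto
  qed
  moreover have "f ` ?M \<subseteq> B"
    using f by blast
  ultimately show ?thesis
    using assms(2) by (rule card_inj_on_le)
qed

lemma edge_avoiding:
  assumes "linear_family F" "finite B" "q \<notin> B" "card B < card {e\<in>F. q \<in> e}"
  obtains e where "e \<in> F" "q \<in> e" "e \<inter> B = {}"
proof -
  have "{e\<in>F. q \<in> e \<and> e \<inter> B \<noteq> {}} \<noteq> {e\<in>F. q \<in> e}"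
    using card_edges_meeting_le[OF assms(1-3)] assms(4) by (metis linorder_not_less)
  then show thesis
    using that by blast
qed

lemma card_three_no_four:
  assumes "card e = 3" "{a, b, c, d} \<subseteq> e" "distinct [a, b, c, d]"
  shows False
proof -
  have "finite e"
    using assms(1) by (intro card_ge_0_finite) simp
  then have "card {a, b, c, d} \<le> 3"
    using assms(1,2) card_mono by metis
  then show False
    using distinct_card[OF assms(3)] by simp
qed

text \<open>Of the edges already used by the path, only the last one can contain both \<open>q\<close> and a vertex
  outside the path, and it contains at most one such vertex. So two spare neighbours suffice.\<close>

lemma neighbour_outside_path:
  assumes path: "berge_path F (q # ps) es"
    and three: "\<And>e. e \<in> F \<Longrightarrow> card e = 3"
    and B: "finite B" "set ps \<subseteq> B" "q \<notin> B"
    and X: "X \<subseteq> {y. y \<noteq> q \<and> (\<exists>e\<in>F. q \<in> e \<and> y \<in> e)}" "card B + 2 \<le> card X"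
  shows "\<exists>e\<in>F. \<exists>y\<in>e. q \<in> e \<and> y \<in> X - B \<and> e \<notin> set es"
proof (rule ccontr)
  assume "\<not> ?thesis"
  then have used: "e \<in> set es" if "e \<in> F" "q \<in> e" "y \<in> e" "y \<in> X - B" for e y
    using that by blast
  have first: "e = es ! 0 \<and> ps ! 0 \<in> e \<inter> B" if e: "e \<in> F" "q \<in> e" "y \<in> e" "y \<in> X - B" for e y
  proof -
    obtain i where i: "i < length es" "e = es ! i"
      using used[OF e] by (metis in_set_conv_nth)
    have len: "length ps = length es" and dist: "distinct (q # ps)"
      using path unfolding berge_path_def by auto
    have ps: "(q # ps) ! i \<in> e" "ps ! i \<in> e" "ps ! i \<in> B"
      using path i len B(2) unfolding berge_path_def by auto
    \<comment> \<open>A later edge of the path already joins two vertices of \<open>ps\<close>; with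
      \<open>q\<close> and \<open>y\<close> it would have four points.\<close>
    have "i = 0"
    proof (rule ccontr)
      assume "i \<noteq> 0"
      then obtain j where j: "i = Suc j"
        by (cases i) auto
      have "ps ! j \<in> e" "ps ! j \<in> B" "ps ! j \<noteq> ps ! i"
        using ps(1) j i len B(2) dist by (auto simp: nth_eq_iff_index_eq)
      then show False
        using card_three_no_four[OF three[OF e(1)], of q y "ps ! j" "ps ! i"] e ps X(1) B(3) by auto
    qed
    then show ?thesis
      using i ps by auto
  qed
  have "card X - card B \<le> card (X - B)"
    by (rule diff_card_le_card_Diff[OF B(1)])
  then have "2 \<le> card (X - B)"
    using X(2) by simp
  then obtain y z where yz: "y \<in> X - B" "z \<in> X - B" "y \<noteq> z"
    by (meson card_2_iff' obtain_subset_with_card_n subset_iff)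
  obtain d e where d: "d \<in> F" "q \<in> d" "y \<in> d" and e: "e \<in> F" "q \<in> e" "z \<in> e"
    using X(1) yz by blast
  \<comment> \<open>Both spare neighbours lie on the first edge of the path, together with
    \<open>q\<close> and \<open>ps ! 0\<close>: again four points.\<close>
  have "d = e" "ps ! 0 \<in> d \<inter> B"
    using first[OF d yz(1)] first[OF e yz(2)] by auto
  then show False
    using card_three_no_four[OF three[OF d(1)], of q y z "ps ! 0"] d e yz X(1) B(3) by auto
qed

lemma berge_path_greedy:
  assumes lin: "linear_family F"
    and deg: "\<And>q. q \<in> S \<Longrightarrow> q \<in> \<Union>F \<Longrightarrow> t < card {e\<in>F. q \<in> e}"
    and step: "\<And>e q. e \<in> F \<Longrightarrow> q \<in> e \<Longrightarrow> q \<in> S \<Longrightarrow> \<exists>y\<in>e. y \<in> S \<and> y \<noteq> q"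
    and start: "berge_path F ps es" "hd ps \<in> S" "hd ps \<in> \<Union>F" "length es \<le> t"
  shows "\<exists>qs fs. berge_path F qs fs \<and> hd qs \<in> S \<and> hd qs \<in> \<Union>F \<and> last qs = last ps \<and> length fs = t"
  using start
proof (induction "t - length es" arbitrary: ps es)
  case 0
  then have "length es = t"
    by simp
  then show ?case
    using 0 by blast
next
  case (Suc n)
  obtain q qs where ps: "ps = q # qs"
    using Suc.prems(1) unfolding berge_path_def by (cases ps) auto
  have qs: "length qs = length es" "q \<notin> set qs" "distinct qs"
    using Suc.prems(1) ps unfolding berge_path_def by auto
  then have "card (set qs) < card {e\<in>F. q \<in> e}"
    using deg[of q] Suc.prems ps by (simp add: distinct_card)
  then obtain e where e: "e \<in> F" "q \<in> e" "e \<inter> set qs = {}"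
    using edge_avoiding[OF lin] \<open>q \<notin> set qs\<close> by blast
  obtain y where y: "y \<in> e" "y \<in> S" "y \<noteq> q"
    using step[of e q] e Suc.prems(2) ps by auto
  have "berge_path F (y # ps) (e # es)"
    using Suc.prems(1) e y berge_path_edge_meets[of F q qs es e] unfolding ps
    by (intro berge_path_Cons) auto
  moreover have "n = t - length (e # es)" "length (e # es) \<le> t"
    using Suc.hyps(2) by auto
  moreover have "hd (y # ps) \<in> S" "hd (y # ps) \<in> \<Union>F" "last (y # ps) = last ps"
    using y e ps by auto
  ultimately show ?case
    using Suc.hyps(1)[of "e # es" "y # ps"] by metis
qed

text \<open>Delete vertices of weighted degree at most \<open>c\<close> one by one, together with
  their edges. Each deletion costs at most \<open>c\<close>, so the strict inequality survives and
  keeps the family nonempty.\<close>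

lemma dense_subfamily:
  fixes w :: "'a set \<Rightarrow> nat"
  assumes "finite S" "finite F" "\<And>e. e \<in> F \<Longrightarrow> e \<inter> S \<noteq> {}" "c * card S < (\<Sum>e\<in>F. w e)"
  shows "\<exists>G\<subseteq>F. G \<noteq> {} \<and> (\<forall>v\<in>S. v \<in> \<Union>G \<longrightarrow> c < (\<Sum>e | e \<in> G \<and> v \<in> e. w e))"
  using assms
proof (induction S arbitrary: F rule: finite_psubset_induct)
  case (psubset S)
  show ?case
  proof (cases "\<forall>v\<in>S. v \<in> \<Union>F \<longrightarrow> c < (\<Sum>e | e \<in> F \<and> v \<in> e. w e)")
    case True
    then show ?thesis
      using psubset.prems(3) by (intro exI[of _ F]) auto
  next
    case False
    then obtain x where x: "x \<in> S" "(\<Sum>e | e \<in> F \<and> x \<in> e. w e) \<le> c"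
      by force
    define D where "D = {e\<in>F. x \<notin> e}"
    have "(\<Sum>e\<in>F. w e) = (\<Sum>e\<in>D. w e) + (\<Sum>e | e \<in> F \<and> x \<in> e. w e)"
      unfolding D_def using psubset.prems(1)
      by (subst sum.union_disjoint[symmetric]) (auto intro!: sum.cong)
    moreover have "card S = Suc (card (S - {x}))"
      using psubset.hyps x(1) by (metis card.remove)
    ultimately have "c * card (S - {x}) < (\<Sum>e\<in>D. w e)"
      using psubset.prems(3) x(2) by simp
    moreover have "e \<inter> (S - {x}) \<noteq> {}" if "e \<in> D" for e
      using psubset.prems(2)[of e] that unfolding D_def by blast
    ultimately obtain G where G: "G \<subseteq> D" "G \<noteq> {}"
        "\<forall>v\<in>S - {x}. v \<in> \<Union>G \<longrightarrow> c < (\<Sum>e | e \<in> G \<and> v \<in> e. w e)"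
      using psubset.IH[of "S - {x}" D] psubset.prems(1) x(1) unfolding D_def by auto
    \<comment> \<open>The condition at the deleted vertex \<open>x\<close> is vacuous for
      \<open>G\<close>.\<close>
    moreover have "x \<notin> \<Union>G" "G \<subseteq> F"
      using G(1) unfolding D_def by auto
    ultimately show ?thesis
      by blast
  qed
qed

section \<open>Berge cycles through a vertex\<close>

text \<open>Two indices that are each other's successor would give 2 = 0 modulo \<open>l\<close>,
  which \<open>3 \<le> l\<close> excludes.\<close>

lemma inj_on_cycle_edge:
  assumes "3 \<le> (l :: nat)"
  shows "inj_on (\<lambda>i. {i, (i + 1) mod l}) {..<l}"
proof (rule inj_onI)
  fix i j assume ij: "i \<in> {..<l}" "j \<in> {..<l}" "{i, (i + 1) mod l} = {j, (j + 1) mod l}"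
  then have "i = j \<or> (i = (j + 1) mod l \<and> j = (i + 1) mod l)"
    by (auto simp: doubleton_eq_iff)
  then show "i = j"
    using ij(1,2) assms by (auto simp: mod_Suc split: if_splits)
qed

lemma not_berge_free_cycleI:
  assumes "k_graph k H" "3 \<le> l" "length vs = l" "length gs = l" "distinct vs" "distinct gs"
    and "set vs \<subseteq> verts H" "set gs \<subseteq> edges H"
    and mem: "\<And>i. i < l \<Longrightarrow> vs ! i \<in> gs ! i \<and> vs ! ((i + 1) mod l) \<in> gs ! i"
  shows "\<not> berge_free (cycle_graph l) H"
proof -
  let ?c = "\<lambda>i. {i, (i + 1) mod l}"
  \<comment> \<open>Sends the cycle edge from \<open>i\<close> to its successor to
    \<open>gs ! i\<close>.\<close>
  define \<phi> where "\<phi> = (\<lambda>e. gs ! the_inv_into {..<l} ?c e)"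
  have inj: "inj_on ?c {..<l}"
    by (rule inj_on_cycle_edge[OF assms(2)])
  have \<phi>: "\<phi> (?c i) = gs ! i" if "i < l" for i
    using the_inv_into_f_f[OF inj, of i] that unfolding \<phi>_def by simp
  have "bij_betw (\<lambda>e. the_inv_into {..<l} ?c e) (?c ` {..<l}) {..<l}"
    using bij_betw_the_inv_into[OF inj_on_imp_bij_betw[OF inj]] .
  then have "bij_betw (nth gs \<circ> (\<lambda>e. the_inv_into {..<l} ?c e)) (?c ` {..<l}) (set gs)"
    using bij_betw_nth[OF assms(6), of "{..<l}" "set gs"] assms(4) by (intro bij_betw_trans) auto
  then have "bij_betw \<phi> (?c ` {..<l}) (set gs)"
    unfolding \<phi>_def comp_def .
  moreover have "inj_on (nth vs) {..<l}"
    using assms(3,5) by (intro inj_on_nth) auto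
  moreover have "nth vs ` {..<l} \<subseteq> verts H"
    using assms(3,7) by auto
  moreover have "nth vs ` ?c i \<subseteq> \<phi> (?c i)" if "i < l" for i
    using \<phi>[OF that] mem[OF that] by simp
  ultimately have "berge (cycle_graph l) \<lparr>verts = verts H, edges = set gs\<rparr>"
    unfolding berge_def cycle_graph_def by (intro exI[of _ "nth vs"] exI[of _ \<phi>]) auto
  moreover have "subhypergraph \<lparr>verts = verts H, edges = set gs\<rparr> H"
    using assms(1,8) unfolding subhypergraph_def k_graph_def by auto
  ultimately show ?thesis
    unfolding berge_free_def by blast
qed

lemma not_berge_free_cycle_path:
  assumes H: "k_graph k H" and u: "u \<in> verts H"
    and F: "F \<subseteq> edges H" "\<And>e. e \<in> F \<Longrightarrow> u \<notin> e"
    and path: "berge_path F ps es" "length es + 2 = l" "es \<noteq> []"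
    and d: "d \<in> edges H" "u \<in> d" "hd ps \<in> d"
    and e: "e \<in> edges H" "u \<in> e" "last ps \<in> e" "d \<noteq> e"
  shows "\<not> berge_free (cycle_graph l) H"
proof (rule not_berge_free_cycleI[OF H])
  \<comment> \<open>The cycle leaves \<open>u\<close> through \<open>d\<close>, runs along the path
    and returns through \<open>e\<close>. It has \<open>length es + 2\<close> edges.\<close>
  let ?vs = "u # ps" and ?gs = "d # es @ [e]"
  have len: "length ps = Suc (length es)" and dist: "distinct ps" "distinct es" and es: "set es \<subseteq> F"
    and inc: "\<And>i. i < length es \<Longrightarrow> ps ! i \<in> es ! i \<and> ps ! Suc i \<in> es ! i"
    using path(1) unfolding berge_path_def by auto
  show "3 \<le> l" "length ?vs = l" "length ?gs = l"
    using path(2,3) len by (cases es; simp)+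
  \<comment> \<open>Since \<open>es\<close> is nonempty, each path vertex lies on an edge of
    \<open>F\<close>, and so differs from \<open>u\<close>.\<close>
  have ps: "\<exists>f\<in>F. x \<in> f" if x: "x \<in> set ps" for x
  proof -
    obtain i where i: "i < length ps" "x = ps ! i"
      using x by (metis in_set_conv_nth)
    show ?thesis
    proof (cases i)
      case 0
      then have "x \<in> es ! 0" "es ! 0 \<in> set es"
        using inc[of 0] i path(3) by auto
      then show ?thesis
        using es by blast
    next
      case (Suc j)
      then have "x \<in> es ! j" "es ! j \<in> set es"
        using inc[of j] i len by auto
      then show ?thesis
        using es by blast
    qed
  qed
  show "distinct ?vs"
    using dist ps F(2) by auto
  show "distinct ?gs"
    using dist es F(2) d(2) e(2,4) by auto
  show "set ?vs \<subseteq> verts H"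
    using ps F(1) H u unfolding k_graph_def by auto
  show "set ?gs \<subseteq> edges H"
    using d(1) e(1) es F(1) by auto
  show "?vs ! i \<in> ?gs ! i \<and> ?vs ! ((i + 1) mod l) \<in> ?gs ! i" if i: "i < l" for i
  proof -
    consider "i = 0" | j where "i = Suc j" "j < length es" | "i = Suc (length es)"
      using i path(2) by (cases i) force+
    then show ?thesis
    proof cases
      case 1
      have "ps \<noteq> []"
        using len by auto
      then show ?thesis
        using 1 d path(2) by (simp add: hd_conv_nth)
    next
      case 2
      then show ?thesis
        using inc[of j] path(2) by (auto simp: nth_append)
    next
      case 3
      have "ps ! length es = last ps"
        using len by (subst last_conv_nth) auto
      then show ?thesis
        using 3 e path(2) by (auto simp: nth_append)
    qed
  qed
qed

text \<open>The vertices to be avoided are those of the path and the third vertex of the edge that joins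
  \<open>u\<close> to the first vertex of the path.\<close>

lemma link_path_end:
  assumes H: "k_graph 3 H" "linear_hypergraph H" "berge_free (cycle_graph l) H"
    and u: "u \<in> verts H"
    and F: "F \<subseteq> edges H" "\<And>e. e \<in> F \<Longrightarrow> u \<notin> e"
    and path: "berge_path F (q # ps) es" "length es + 3 = l" "es \<noteq> []"
    and a: "adjacent H u (last (q # ps))"
  obtains B where "finite B" "set ps \<subseteq> B" "q \<notin> B" "card B \<le> length es + 1"
    "\<And>e y. e \<in> F \<Longrightarrow> e \<notin> set es \<Longrightarrow> q \<in> e \<Longrightarrow> y \<in> e \<Longrightarrow> adjacent H u y \<Longrightarrow> y \<in> B \<or> y = q"
proof -
  define a where "a = last (q # ps)"
  have len: "length ps = length es" and dist: "distinct (q # ps)"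
    using path(1) unfolding berge_path_def by auto
  then have "ps \<noteq> []"
    using path(3) by auto
  then have a_ps: "a \<in> set ps" "a = last ps"
    unfolding a_def by auto
  obtain c where c: "c \<in> edges H" "u \<in> c" "a \<in> c" "u \<noteq> a"
    using a unfolding adjacent_def a_def by blast
  \<comment> \<open>The fixed end \<open>a\<close> is in \<open>set ps\<close> already, so
    \<open>c\<close> adds at most its third vertex. The current end \<open>q\<close> is left out
    because the edges considered pass through it.\<close>
  define B where "B = (set ps \<union> (c - {u})) - {q}"
  have "finite c" and c3: "card c = 3"
    using H(1) c(1) finite_subset unfolding k_graph_def by auto
  then have c1: "card (c - {u, a}) = 1"
    using c by (subst card_Diff_subset) auto
  have "card B \<le> card (set ps \<union> (c - {u, a}))"
    using \<open>finite c\<close> a_ps unfolding B_def by (intro card_mono) auto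
  also have "\<dots> \<le> card (set ps) + 1"
    using card_Un_le[of "set ps" "c - {u, a}"] c1 by simp
  also have "card (set ps) = length es"
    using dist len distinct_card by fastforce
  finally have "card B \<le> length es + 1" .
  moreover have "finite B" "set ps \<subseteq> B" "q \<notin> B"
    using \<open>finite c\<close> dist unfolding B_def by auto
  moreover have "y \<in> B \<or> y = q"
    if e: "e \<in> F" "e \<notin> set es" "q \<in> e" "y \<in> e" and y: "adjacent H u y" for e y
  proof (rule ccontr)
    assume out: "\<not> (y \<in> B \<or> y = q)"
    obtain d where d: "d \<in> edges H" "u \<in> d" "y \<in> d" "u \<noteq> y"
      using y unfolding adjacent_def by blast
    \<comment> \<open>As \<open>y\<close> avoids \<open>c\<close>, the edges at \<open>u\<close>
      that close the cycle are distinct; the extended path has \<open>l - 2\<close> edges.\<close>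
    have "d \<noteq> c"
      using out d unfolding B_def by auto
    moreover have "berge_path F (y # q # ps) (e # es)"
      using berge_path_Cons[OF path(1) e] out unfolding B_def by auto
    moreover have "last (y # q # ps) \<in> c"
      using c(3) unfolding a_def by simp
    ultimately show False
      using not_berge_free_cycle_path[OF H(1) u F, of "y # q # ps" "e # es" l d c] path(2) d c H(3)
      by auto
  qed
  ultimately show thesis
    using that by blast
qed

section \<open>Degree sums over the neighbourhood of a vertex\<close>

text \<open>By linearity the edges at \<open>q\<close> are disjoint apart from \<open>q\<close>.
  Each contributes 1 for \<open>q\<close> itself plus its other points in \<open>S\<close>.\<close>

lemma sum_card_Int_neighbours:
  assumes "linear_family F" "finite F" "finite S" "q \<in> S"
  shows "(\<Sum>e | e \<in> F \<and> q \<in> e. card (e \<inter> S)) =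
    card {e\<in>F. q \<in> e} + card {y\<in>S. y \<noteq> q \<and> (\<exists>e\<in>F. q \<in> e \<and> y \<in> e)}"
proof -
  let ?G = "{e\<in>F. q \<in> e}"
  have "{y\<in>S. y \<noteq> q \<and> (\<exists>e\<in>F. q \<in> e \<and> y \<in> e)} = (\<Union>e\<in>?G. e \<inter> S - {q})"
    by blast
  moreover have "card (\<Union>e\<in>?G. e \<inter> S - {q}) = (\<Sum>e\<in>?G. card (e \<inter> S - {q}))"
  proof (rule card_UN_disjoint)
    show "\<forall>d\<in>?G. \<forall>e\<in>?G. d \<noteq> e \<longrightarrow> (d \<inter> S - {q}) \<inter> (e \<inter> S - {q}) = {}"
      using linear_familyD[OF assms(1), where x = q] by (fastforce simp: disjoint_iff)
  qed (use assms in auto)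
  moreover have "(\<Sum>e\<in>?G. card (e \<inter> S)) = (\<Sum>e\<in>?G. 1 + card (e \<inter> S - {q}))"
  proof (rule sum.cong)
    fix e assume "e \<in> ?G"
    then show "card (e \<inter> S) = 1 + card (e \<inter> S - {q})"
      using assms(3,4) card.remove[of "e \<inter> S" q] by auto
  qed simp
  ultimately show ?thesis
    by (simp add: sum_Suc)
qed

text \<open>Otherwise a dense subfamily carries a path that starts in \<open>N\<close>, continues in
  \<open>W\<close> and, after \<open>l - 3\<close> edges, can step back into \<open>N\<close>, which
  closes a Berge cycle.\<close>

lemma link_single_edges_le:
  assumes H: "k_graph 3 H" "linear_hypergraph H" "berge_free (cycle_graph l) H" "4 \<le> l"
    and u: "u \<in> verts H"
  defines "N \<equiv> {v. adjacent H u v}"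
  shows "card {e\<in>edges H. u \<notin> e \<and> card (e \<inter> N) = 1} \<le> (l - 2) * card (verts H - {u} - N)"
proof (rule ccontr)
  define W where "W = verts H - {u} - N"
  define F where "F = {e\<in>edges H. u \<notin> e \<and> card (e \<inter> N) = 1}"
  assume "\<not> ?thesis"
  then have less: "(l - 2) * card W < (\<Sum>e\<in>F. 1)"
    unfolding W_def F_def by simp
  have fin: "finite (verts H)" and sub: "\<And>e. e \<in> edges H \<Longrightarrow> e \<subseteq> verts H \<and> card e = 3"
    using H(1) unfolding k_graph_def by auto
  have "finite W" "finite F"
    using fin sub finite_subset[of F "Pow (verts H)"] unfolding W_def F_def by auto
  \<comment> \<open>Two vertices outside \<open>N\<close> on every edge let the walk leave each
    vertex of \<open>W\<close> for another vertex of \<open>W\<close>.\<close>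
  have card_W: "card (e \<inter> W) = 2" if "e \<in> F" for e
  proof -
    have "finite e" "e \<inter> W = e - (e \<inter> N)"
      using that sub finite_subset[OF _ fin] unfolding F_def W_def by auto
    then show ?thesis
      using that sub by (simp add: F_def card_Diff_subset)
  qed
  have meets: "e \<inter> W \<noteq> {}" if "e \<in> F" for e
    using card_W[OF that] by auto
  obtain G where G: "G \<subseteq> F" "G \<noteq> {}"
      "\<forall>v\<in>W. v \<in> \<Union>G \<longrightarrow> l - 2 < (\<Sum>e | e \<in> G \<and> v \<in> e. 1)"
    using dense_subfamily[OF \<open>finite W\<close> \<open>finite F\<close> meets less] by blast
  have lin: "linear_family G"
    using linear_family_subset[OF linear_family_edges[OF H(1,2)]] G(1) unfolding F_def by blast
  have deg: "l - 2 < card {e\<in>G. v \<in> e}" if "v \<in> W" "v \<in> \<Union>G" for v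
    using G(3) that by simp
  have inW: "\<exists>y\<in>e. y \<in> W \<and> y \<noteq> q" if "e \<in> G" for e q
  proof (rule ccontr)
    assume "\<not> ?thesis"
    then have "e \<inter> W \<subseteq> {q}"
      by blast
    then show False
      using card_W[of e] that G(1) card_mono[of "{q}" "e \<inter> W"] by auto
  qed
  have inN: "\<exists>y\<in>e. y \<in> N" if "e \<in> G" for e
    using that G(1) card_gt_0_iff[of "e \<inter> N"] unfolding F_def by auto
  obtain e a w where e: "e \<in> G" "a \<in> e" "a \<in> N" "w \<in> e" "w \<in> W" "w \<noteq> a"
    using G(2) inN inW by (meson ex_in_conv)
  \<comment> \<open>The fixed end \<open>a\<close> is a neighbour of \<open>u\<close>; all later
    vertices are taken from \<open>W\<close>.\<close>
  then have "berge_path G [w, a] [e]"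
    unfolding berge_path_def by auto
  then have "\<exists>ps es. berge_path G ps es \<and> hd ps \<in> W \<and> hd ps \<in> \<Union>G \<and> last ps = last [w, a] \<and> length es = l - 3"
  proof (rule berge_path_greedy[OF lin, rotated 2])
    show "l - 3 < card {e\<in>G. v \<in> e}" if "v \<in> W" "v \<in> \<Union>G" for v
      using deg[OF that] by simp
  qed (use inW e H(4) in auto)
  then obtain ps es where path: "berge_path G ps es" "hd ps \<in> W" "hd ps \<in> \<Union>G"
      "last ps = a" "length es = l - 3"
    by auto
  then obtain q qs where ps: "ps = q # qs"
    unfolding berge_path_def by (cases ps) auto
  have "G \<subseteq> edges H" "\<And>e. e \<in> G \<Longrightarrow> u \<notin> e"
    using G(1) unfolding F_def by auto
  moreover have "length es + 3 = l" "es \<noteq> []" "adjacent H u (last (q # qs))"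
    using path H(4) e(3) ps unfolding N_def by auto
  ultimately obtain B where B: "finite B" "set qs \<subseteq> B" "q \<notin> B" "card B \<le> length es + 1"
      "\<And>e y. e \<in> G \<Longrightarrow> e \<notin> set es \<Longrightarrow> q \<in> e \<Longrightarrow> y \<in> e \<Longrightarrow> adjacent H u y \<Longrightarrow> y \<in> B \<or> y = q"
    using link_path_end[OF H(1-3) u, of G q qs es] path(1) ps by metis
  \<comment> \<open>Here \<open>card B\<close> is at most \<open>l - 2\<close>, which the degree of
    \<open>q\<close> exceeds.\<close>
  have "card B < card {e\<in>G. q \<in> e}"
    using B(4) deg[of q] path ps H(4) by auto
  then obtain f where f: "f \<in> G" "q \<in> f" "f \<inter> B = {}"
    using edge_avoiding[OF lin B(1,3)] by blast
  have "f \<notin> set es"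
    using berge_path_edge_meets[of G q qs es f] path(1) ps B(2) f(3) by auto
  moreover obtain y where y: "y \<in> f" "y \<in> N"
    using inN[OF f(1)] by blast
  moreover have "y \<noteq> q"
    using path(2) ps y(2) unfolding W_def by auto
  ultimately show False
    using B(5)[of f y] f unfolding N_def by blast
qed

text \<open>Every edge considered has at least two vertices in \<open>N\<close>, so the whole path
  can stay in \<open>N\<close>. Weighting an edge by \<open>card (e \<inter> N)\<close> makes a
  large weight at a vertex mean many edges or many neighbours in \<open>N\<close>.\<close>

lemma link_multiple_edges_le:
  assumes H: "k_graph 3 H" "linear_hypergraph H" "berge_free (cycle_graph l) H" "5 \<le> l"
    and u: "u \<in> verts H"
  defines "N \<equiv> {v. adjacent H u v}"
  shows "(\<Sum>e | e \<in> edges H \<and> u \<notin> e \<and> 2 \<le> card (e \<inter> N). card (e \<inter> N)) \<le> (3 * l - 8) * card N"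
proof (rule ccontr)
  define F where "F = {e\<in>edges H. u \<notin> e \<and> 2 \<le> card (e \<inter> N)}"
  assume "\<not> ?thesis"
  then have less: "(3 * l - 8) * card N < (\<Sum>e\<in>F. card (e \<inter> N))"
    unfolding F_def by simp
  have fin: "finite (verts H)" and sub: "\<And>e. e \<in> edges H \<Longrightarrow> e \<subseteq> verts H \<and> card e = 3"
    using H(1) unfolding k_graph_def by auto
  have "N \<subseteq> verts H"
    using sub unfolding N_def adjacent_def by blast
  then have "finite N" "finite F"
    using fin sub finite_subset[of F "Pow (verts H)"] finite_subset[of N "verts H"]
    unfolding F_def by auto
  have meets: "e \<inter> N \<noteq> {}" if "e \<in> F" for e
    using that unfolding F_def by auto
  obtain G where G: "G \<subseteq> F" "G \<noteq> {}"
      "\<forall>v\<in>N. v \<in> \<Union>G \<longrightarrow> 3 * l - 8 < (\<Sum>e | e \<in> G \<and> v \<in> e. card (e \<inter> N))"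
    using dense_subfamily[OF \<open>finite N\<close> \<open>finite F\<close> meets less] by blast
  have lin: "linear_family G"
    using linear_family_subset[OF linear_family_edges[OF H(1,2)]] G(1) unfolding F_def by blast
  have three: "card e = 3" "card (e \<inter> N) \<le> 3" if "e \<in> G" for e
  proof -
    show "card e = 3"
      using that G(1) sub unfolding F_def by auto
    then show "card (e \<inter> N) \<le> 3"
      using card_mono[of e "e \<inter> N"] card_ge_0_finite[of e] by auto
  qed
  \<comment> \<open>Each edge weighs at most 3, so weight at least \<open>3 * l - 7\<close> requires
    at least \<open>l - 2\<close> edges.\<close>
  have deg: "l - 3 < card {e\<in>G. v \<in> e}" if "v \<in> N" "v \<in> \<Union>G" for v
  proof -
    have "(\<Sum>e | e \<in> G \<and> v \<in> e. card (e \<inter> N)) \<le> card {e\<in>G. v \<in> e} * 3"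
      using three(2) sum_bounded_above[of "{e\<in>G. v \<in> e}" "\<lambda>e. card (e \<inter> N)" 3] by simp
    then show ?thesis
      using G(3) that H(4) by fastforce
  qed
  have inN: "\<exists>y\<in>e. y \<in> N \<and> y \<noteq> q" if "e \<in> G" for e q
  proof (rule ccontr)
    assume "\<not> ?thesis"
    then have "e \<inter> N \<subseteq> {q}"
      by blast
    then show False
      using that G(1) card_mono[of "{q}" "e \<inter> N"] unfolding F_def by auto
  qed
  obtain e a where e: "e \<in> G" "a \<in> e" "a \<in> N"
    using G(2) inN by (meson ex_in_conv)
  have "berge_path G [a] []"
    unfolding berge_path_def by auto
  then have "\<exists>ps es. berge_path G ps es \<and> hd ps \<in> N \<and> hd ps \<in> \<Union>G \<and> last ps = last [a] \<and> length es = l - 3"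
  proof (rule berge_path_greedy[OF lin, rotated 2])
    show "l - 3 < card {e\<in>G. v \<in> e}" if "v \<in> N" "v \<in> \<Union>G" for v
      using deg[OF that] by simp
  qed (use inN e H(4) in auto)
  then obtain ps es where path: "berge_path G ps es" "hd ps \<in> N" "hd ps \<in> \<Union>G"
      "last ps = a" "length es = l - 3"
    by auto
  then obtain q qs where ps: "ps = q # qs"
    unfolding berge_path_def by (cases ps) auto
  have "G \<subseteq> edges H" "\<And>e. e \<in> G \<Longrightarrow> u \<notin> e"
    using G(1) unfolding F_def by auto
  moreover have "length es + 3 = l" "es \<noteq> []" "adjacent H u (last (q # qs))"
    using path H(4) e(3) ps unfolding N_def by auto
  ultimately obtain B where B: "finite B" "set qs \<subseteq> B" "q \<notin> B" "card B \<le> length es + 1"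
      "\<And>e y. e \<in> G \<Longrightarrow> e \<notin> set es \<Longrightarrow> q \<in> e \<Longrightarrow> y \<in> e \<Longrightarrow> adjacent H u y \<Longrightarrow> y \<in> B \<or> y = q"
    using link_path_end[OF H(1-3) u, of G q qs es] path(1) ps by metis
  have q: "q \<in> N" "q \<in> \<Union>G"
    using path ps by auto
  \<comment> \<open>If \<open>q\<close> lies on few edges, these meet \<open>N\<close> in many vertices, so \<open>q\<close> has many neighbours in \<open>N\<close>.\<close>
  show False
  proof (cases "card B < card {e\<in>G. q \<in> e}")
    case True
    then obtain f where f: "f \<in> G" "q \<in> f" "f \<inter> B = {}"
      using edge_avoiding[OF lin B(1,3)] by blast
    have "f \<notin> set es"
      using berge_path_edge_meets[of G q qs es f] path(1) ps B(2) f(3) by auto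
    moreover obtain y where y: "y \<in> f" "y \<in> N" "y \<noteq> q"
      using inN[OF f(1)] by blast
    ultimately show False
      using B(5)[of f y] f unfolding N_def by blast
  next
    case False
    define X where "X = {y\<in>N. y \<noteq> q \<and> (\<exists>e\<in>G. q \<in> e \<and> y \<in> e)}"
    have "finite G"
      using \<open>finite F\<close> G(1) finite_subset by blast
    then have "3 * l - 8 < card {e\<in>G. q \<in> e} + card X"
      using sum_card_Int_neighbours[OF lin _ \<open>finite N\<close> q(1)] G(3)[rule_format, OF q]
      unfolding X_def by simp
    \<comment> \<open>With degree at most \<open>card B\<close> and \<open>card B\<close> at most
      \<open>l - 2\<close>, it suffices that \<open>2 * (l - 2) + 2 \<le> 3 * l - 7\<close>, which
      is exactly \<open>5 \<le> l\<close>.\<close>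
    then have "card B + 2 \<le> card X"
      using False B(4) path(5) H(4) by linarith
    then obtain f y where f: "f \<in> G" "y \<in> f" "q \<in> f" "y \<in> X - B" "f \<notin> set es"
      using neighbour_outside_path[of G q qs es B X] path(1) ps three(1) B(1-3)
      unfolding X_def by blast
    then show False
      using B(5)[of f y] unfolding X_def N_def by blast
  qed
qed

text \<open>By linearity the sets \<open>e - {u}\<close> partition the neighbourhood of
  \<open>u\<close>.\<close>

lemma sum_neighbours:
  fixes g :: "'a \<Rightarrow> 'b::comm_monoid_add"
  assumes "k_graph k H" "linear_hypergraph H"
  shows "(\<Sum>v | adjacent H u v. g v) = (\<Sum>e | e \<in> edges H \<and> u \<in> e. \<Sum>v\<in>e - {u}. g v)"
proof -
  have fin: "finite (verts H)" "edges H \<subseteq> Pow (verts H)"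
    using assms(1) unfolding k_graph_def by auto
  have "{v. adjacent H u v} = (\<Union>e\<in>{e\<in>edges H. u \<in> e}. e - {u})"
    unfolding adjacent_def by blast
  also have "sum g \<dots> = (\<Sum>e | e \<in> edges H \<and> u \<in> e. \<Sum>v\<in>e - {u}. g v)"
  proof (rule sum.UNION_disjoint)
    show "finite {e\<in>edges H. u \<in> e}"
      using fin finite_subset[of "edges H" "Pow (verts H)"] by simp
    show "\<forall>e\<in>{e\<in>edges H. u \<in> e}. finite (e - {u})"
      using fin finite_subset[of _ "verts H"] by blast
    show "\<forall>d\<in>{e\<in>edges H. u \<in> e}. \<forall>e\<in>{e\<in>edges H. u \<in> e}. d \<noteq> e \<longrightarrow> (d - {u}) \<inter> (e - {u}) = {}"
      using linear_familyD[OF linear_family_edges[OF assms], where x = u]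
      by (fastforce simp: disjoint_iff)
  qed
  finally show ?thesis .
qed

lemma link_degree_sum_le:
  assumes H: "k_graph 3 H" "linear_hypergraph H" "berge_free (cycle_graph l) H" "5 \<le> l"
    and u: "u \<in> verts H"
  shows "(\<Sum>v | adjacent H u v. card {e\<in>edges H. v \<in> e}) \<le> (3 * l - 7) * (card (verts H) - 1)"
proof -
  define N where "N = {v. adjacent H u v}"
  define W where "W = verts H - {u} - N"
  have fin: "finite (verts H)" and sub: "\<And>e. e \<in> edges H \<Longrightarrow> e \<subseteq> verts H \<and> card e = 3"
    using H(1) unfolding k_graph_def by auto
  have N: "N \<subseteq> verts H - {u}"
    using sub unfolding N_def adjacent_def by blast
  then have "finite N"
    using fin finite_subset by blast
  have "finite (edges H)"
    using fin sub finite_subset[of "edges H" "Pow (verts H)"] by blast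
  have "(\<Sum>v\<in>N. card {e\<in>edges H. v \<in> e}) = (\<Sum>v\<in>N. \<Sum>e\<in>edges H. if v \<in> e then 1 else 0)"
    using \<open>finite (edges H)\<close> by (simp add: sum.If_cases Int_def)
  also have "\<dots> = (\<Sum>e\<in>edges H. \<Sum>v\<in>N. if v \<in> e then 1 else 0)"
    by (rule sum.swap)
  also have "\<dots> = (\<Sum>e\<in>edges H. card (e \<inter> N))"
    using \<open>finite N\<close> by (simp add: sum.If_cases Int_commute)
  also have "\<dots> = (\<Sum>e | e \<in> edges H \<and> u \<in> e. card (e \<inter> N)) + (\<Sum>e | e \<in> edges H \<and> u \<notin> e. card (e \<inter> N))"
    using \<open>finite (edges H)\<close> by (subst sum.union_disjoint[symmetric]) (auto intro!: sum.cong)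
  also have "(\<Sum>e | e \<in> edges H \<and> u \<in> e. card (e \<inter> N)) = card N"
  proof -
    have "e \<inter> N = e - {u}" if "e \<in> edges H" "u \<in> e" for e
      using that unfolding N_def adjacent_def by blast
    then show ?thesis
      using sum_neighbours[OF H(1,2), of "\<lambda>_. 1::nat" u] unfolding N_def by simp
  qed
  \<comment> \<open>Edges that miss \<open>N\<close> contribute nothing.\<close>
  also have "(\<Sum>e | e \<in> edges H \<and> u \<notin> e. card (e \<inter> N)) =
      (\<Sum>e | e \<in> edges H \<and> u \<notin> e \<and> card (e \<inter> N) = 1. card (e \<inter> N)) +
      (\<Sum>e | e \<in> edges H \<and> u \<notin> e \<and> 2 \<le> card (e \<inter> N). card (e \<inter> N))"
    using \<open>finite (edges H)\<close>
    by (subst sum.union_disjoint[symmetric]) (auto intro!: sum.mono_neutral_right)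
  also have "(\<Sum>e | e \<in> edges H \<and> u \<notin> e \<and> card (e \<inter> N) = 1. card (e \<inter> N)) =
      card {e\<in>edges H. u \<notin> e \<and> card (e \<inter> N) = 1}"
    by simp
  \<comment> \<open>The coefficient \<open>l - 2\<close> is enlarged to match the bound for
    \<open>N\<close>, so that \<open>W\<close> and \<open>N\<close> combine to all vertices but
    \<open>u\<close>.\<close>
  also have "\<dots> \<le> (3 * l - 8) * card W"
  proof (rule order_trans)
    show "card {e\<in>edges H. u \<notin> e \<and> card (e \<inter> N) = 1} \<le> (l - 2) * card W"
      using link_single_edges_le[OF H(1-3) _ u] H(4) unfolding N_def W_def by simp
    show "(l - 2) * card W \<le> (3 * l - 8) * card W"
      using H(4) by (intro mult_right_mono) auto
  qed
  also have "(\<Sum>e | e \<in> edges H \<and> u \<notin> e \<and> 2 \<le> card (e \<inter> N). card (e \<inter> N)) \<le> (3 * l - 8) * card N"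
    using link_multiple_edges_le[OF H u] unfolding N_def .
  finally have "(\<Sum>v\<in>N. card {e\<in>edges H. v \<in> e}) \<le> card N + (3 * l - 8) * (card W + card N)"
    by (simp add: add_mult_distrib2)
  also have "card W + card N = card (verts H) - 1"
    using N fin u card_Diff_subset[OF \<open>finite N\<close> N] card_mono[OF _ N] unfolding W_def by simp
  also have "card N + (3 * l - 8) * (card (verts H) - 1) \<le> (1 + (3 * l - 8)) * (card (verts H) - 1)"
    using N fin u card_mono[OF _ N] by simp
  also have "1 + (3 * l - 8) = 3 * l - 7"
    using H(4) by simp
  finally show ?thesis
    unfolding N_def .
qed

section \<open>Eigenvalues\<close>

text \<open>An edge at \<open>i\<close> with other vertices \<open>a\<close> and \<open>b\<close>
  arises from the two index lists \<open>[a, b]\<close> and \<open>[b, a]\<close>, which cancels the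
  factor 1/2!.\<close>

lemma adjacency_tensor_sum:
  fixes x :: "'a \<Rightarrow> complex"
  assumes "k_graph 3 H"
  shows "(\<Sum>js | set js \<subseteq> verts H \<and> length js = 3 - 1. adjacency_tensor 3 H (i # js) * prod_list (map x js)) =
    (\<Sum>e | e \<in> edges H \<and> i \<in> e. \<Prod>w\<in>e - {i}. x w)"
proof -
  define L where "L = {js. set js \<subseteq> verts H \<and> length js = 2}"
  define K where "K = {js\<in>L. set (i # js) \<in> edges H}"
  have fin: "finite (verts H)" and sub: "\<And>e. e \<in> edges H \<Longrightarrow> e \<subseteq> verts H \<and> card e = 3"
    using assms unfolding k_graph_def by auto
  have "finite L"
    unfolding L_def using fin by (rule finite_lists_length_eq)
  then have "finite K"
    unfolding K_def by simp
  have "finite (edges H)"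
    using fin sub finite_subset[of "edges H" "Pow (verts H)"] by blast
  have "(\<Sum>js\<in>L. adjacency_tensor 3 H (i # js) * prod_list (map x js)) = (\<Sum>js\<in>K. prod_list (map x js) / 2)"
    unfolding K_def adjacency_tensor_def using \<open>finite L\<close>
    by (intro sum.mono_neutral_cong_right) auto
  also have "\<dots> = (\<Sum>e | e \<in> edges H \<and> i \<in> e. \<Sum>js | js \<in> K \<and> set (i # js) = e. prod_list (map x js) / 2)"
    using \<open>finite K\<close> \<open>finite (edges H)\<close> by (intro sum.group[symmetric]) (auto simp: K_def)
  also have "\<dots> = (\<Sum>e | e \<in> edges H \<and> i \<in> e. \<Prod>w\<in>e - {i}. x w)"
  proof (rule sum.cong)
    fix e assume "e \<in> {e\<in>edges H. i \<in> e}"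
    then have e: "e \<in> edges H" "i \<in> e" "e \<subseteq> verts H" "card e = 3"
      using sub by auto
    then have "card (e - {i}) = 2"
      by simp
    then obtain a b where ab: "e - {i} = {a, b}" "a \<noteq> b"
      by (auto simp: card_2_iff)
    have "{js\<in>K. set (i # js) = e} = {[a, b], [b, a]}"
    proof (rule set_eqI, rule iffI)
      fix js assume js: "js \<in> {js\<in>K. set (i # js) = e}"
      then obtain c d where cd: "js = [c, d]"
        unfolding K_def L_def by (auto simp: length_Suc_conv numeral_2_eq_2)
      have e_cd: "e = {i, c, d}"
        using js cd by auto
      \<comment> \<open>Three entries that cover a 3-set cannot repeat.\<close>
      then have "distinct [i, c, d]"
        using e(4) by (intro card_distinct) simp
      then have "{c, d} = {a, b}"
        using e_cd ab by auto
      then show "js \<in> {[a, b], [b, a]}"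
        using cd by (auto simp: doubleton_eq_iff)
    next
      fix js assume "js \<in> {[a, b], [b, a]}"
      then have "set js = {a, b}" and "length js = 2"
        by auto
      then have "set js \<subseteq> verts H" "set (i # js) = e" "length js = 2"
        using ab(1) e(3) insert_Diff[OF e(2)] by auto
      then show "js \<in> {js\<in>K. set (i # js) = e}"
        using e(1) unfolding K_def L_def by simp
    qed
    then show "(\<Sum>js | js \<in> K \<and> set (i # js) = e. prod_list (map x js) / 2) = (\<Prod>w\<in>e - {i}. x w)"
      using ab by (simp add: mult.commute)
  qed simp
  finally show ?thesis
    unfolding L_def by simp
qed

lemma eigenvalue_le_link_degree_sum:
  assumes H: "k_graph 3 H" "linear_hypergraph H"
    and ev: "tensor_eigenvalue 3 (verts H) (adjacency_tensor 3 H) \<mu>"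
  shows "\<exists>u\<in>verts H. 2 * (cmod \<mu>)\<^sup>2 \<le> real (\<Sum>v | adjacent H u v. card {e\<in>edges H. v \<in> e})"
proof -
  obtain x where x: "\<exists>i\<in>verts H. x i \<noteq> 0"
      "\<And>i. i \<in> verts H \<Longrightarrow> (\<Sum>e | e \<in> edges H \<and> i \<in> e. \<Prod>w\<in>e - {i}. x w) = \<mu> * (x i)\<^sup>2"
    using ev unfolding tensor_eigenvalue_def adjacency_tensor_sum[OF H(1)] by auto
  define y where "y v = cmod (x v)" for v
  have fin: "finite (verts H)" and sub: "\<And>e. e \<in> edges H \<Longrightarrow> e \<subseteq> verts H \<and> card e = 3"
    using H(1) unfolding k_graph_def by auto
  obtain u where u: "u \<in> verts H" "\<And>v. v \<in> verts H \<Longrightarrow> y v \<le> y u"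
  proof -
    have "Max (y ` verts H) \<in> y ` verts H"
      using fin x(1) by (intro Max_in) auto
    then show thesis
      using that fin by (metis Max_ge finite_imageI image_eqI imageE)
  qed
  have pos: "0 < y u"
  proof -
    obtain i where "i \<in> verts H" "x i \<noteq> 0"
      using x(1) by blast
    then show ?thesis
      using u(2)[of i] less_le_trans[of 0 "y i" "y u"] unfolding y_def by simp
  qed
  have y0: "0 \<le> y v" for v
    unfolding y_def by simp
  have bound: "cmod \<mu> * (y v)\<^sup>2 \<le> (\<Sum>e | e \<in> edges H \<and> v \<in> e. \<Prod>w\<in>e - {v}. y w)" if "v \<in> verts H" for v
  proof -
    have "cmod \<mu> * (y v)\<^sup>2 = cmod (\<mu> * (x v)\<^sup>2)"
      unfolding y_def by (simp add: norm_mult norm_power)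
    also have "\<dots> = cmod (\<Sum>e | e \<in> edges H \<and> v \<in> e. \<Prod>w\<in>e - {v}. x w)"
      using x(2)[OF that] by simp
    also have "\<dots> \<le> (\<Sum>e | e \<in> edges H \<and> v \<in> e. cmod (\<Prod>w\<in>e - {v}. x w))"
      by (rule norm_sum)
    finally show ?thesis
      unfolding y_def by (simp add: prod_norm)
  qed
  have pair: "\<exists>a b. e - {v} = {a, b} \<and> a \<noteq> b \<and> a \<in> verts H \<and> b \<in> verts H" if "e \<in> edges H" "v \<in> e" for e v
  proof -
    have "card (e - {v}) = 2"
      using that sub by simp
    then obtain a b where "e - {v} = {a, b}" "a \<noteq> b"
      by (auto simp: card_2_iff)
    then show ?thesis
      using sub[OF that(1)] by blast
  qed
  \<comment> \<open>A crude estimate at an arbitrary vertex: every factor is replaced by the maximum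
    \<open>y u\<close>.\<close>
  have deg: "cmod \<mu> * (y v)\<^sup>2 \<le> card {e\<in>edges H. v \<in> e} * (y u)\<^sup>2" if "v \<in> verts H" for v
  proof -
    have "(\<Prod>w\<in>e - {v}. y w) \<le> (y u)\<^sup>2" if e: "e \<in> {e\<in>edges H. v \<in> e}" for e
    proof -
      obtain a b where "e - {v} = {a, b}" "a \<noteq> b" "a \<in> verts H" "b \<in> verts H"
        using pair[of e v] e by blast
      then show ?thesis
        using mult_mono[OF u(2) u(2) y0 y0, of a b] by (simp add: power2_eq_square)
    qed
    then show ?thesis
      using bound[OF that] sum_bounded_above[of "{e\<in>edges H. v \<in> e}" _ "(y u)\<^sup>2"]
      by (meson order_trans)
  qed
  have "2 * (cmod \<mu> * (y u)\<^sup>2) \<le> (\<Sum>e | e \<in> edges H \<and> u \<in> e. 2 * (\<Prod>w\<in>e - {u}. y w))"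
    using bound[OF u(1)] by (simp add: sum_distrib_left[symmetric])
  \<comment> \<open>AM-GM produces squares, the form in which the eigenvalue equation bounds the
    entries at the neighbours.\<close>
  also have "\<dots> \<le> (\<Sum>e | e \<in> edges H \<and> u \<in> e. \<Sum>w\<in>e - {u}. (y w)\<^sup>2)"
  proof (rule sum_mono)
    fix e assume "e \<in> {e\<in>edges H. u \<in> e}"
    then obtain a b where "e - {u} = {a, b}" "a \<noteq> b"
      using pair[of e u] by blast
    then show "2 * (\<Prod>w\<in>e - {u}. y w) \<le> (\<Sum>w\<in>e - {u}. (y w)\<^sup>2)"
      using sum_squares_bound[of "y a" "y b"] by (simp add: mult.assoc)
  qed
  also have "\<dots> = (\<Sum>v | adjacent H u v. (y v)\<^sup>2)"
    using sum_neighbours[OF H] by metis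
  \<comment> \<open>The second factor \<open>cmod \<mu>\<close> is what allows \<open>deg\<close> to
    be applied at every neighbour of \<open>u\<close>.\<close>
  finally have "cmod \<mu> * (2 * (cmod \<mu> * (y u)\<^sup>2)) \<le> cmod \<mu> * (\<Sum>v | adjacent H u v. (y v)\<^sup>2)"
    by (rule mult_left_mono) simp
  also have "\<dots> = (\<Sum>v | adjacent H u v. cmod \<mu> * (y v)\<^sup>2)"
    by (rule sum_distrib_left)
  also have "\<dots> \<le> (\<Sum>v | adjacent H u v. card {e\<in>edges H. v \<in> e} * (y u)\<^sup>2)"
    using deg sub by (intro sum_mono) (auto simp: adjacent_def)
  also have "\<dots> = real (\<Sum>v | adjacent H u v. card {e\<in>edges H. v \<in> e}) * (y u)\<^sup>2"
    by (simp add: sum_distrib_right)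
  finally have "(2 * (cmod \<mu>)\<^sup>2) * (y u)\<^sup>2 \<le> real (\<Sum>v | adjacent H u v. card {e\<in>edges H. v \<in> e}) * (y u)\<^sup>2"
    by (simp add: power2_eq_square ac_simps)
  then have "2 * (cmod \<mu>)\<^sup>2 \<le> real (\<Sum>v | adjacent H u v. card {e\<in>edges H. v \<in> e})"
    by (rule mult_right_le_imp_le) (use pos in simp)
  then show ?thesis
    using u(1) by blast
qed

section \<open>The bound on the spectral radius\<close>

text \<open>Guarantees that the supremum is over a nonempty set. The indicator of \<open>v\<close>
  is an eigenvector: each product has two distinct vertices, one of which is not
  \<open>v\<close>.\<close>

lemma tensor_eigenvalue_0:
  assumes "k_graph 3 H" "v \<in> verts H"
  shows "tensor_eigenvalue 3 (verts H) (adjacency_tensor 3 H) 0"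
proof -
  define x :: "'a \<Rightarrow> complex" where "x = (\<lambda>w. if w = v then 1 else 0)"
  have "(\<Prod>w\<in>e - {i}. x w) = 0" if e: "e \<in> edges H" "i \<in> e" for e i
  proof -
    have "card e = 3"
      using assms(1) e(1) unfolding k_graph_def by blast
    then have "card (e - {i}) = 2"
      using e(2) by simp
    then obtain a b where "e - {i} = {a, b}" "a \<noteq> b"
      by (auto simp: card_2_iff)
    then show ?thesis
      unfolding x_def by auto
  qed
  then have "(\<Sum>e | e \<in> edges H \<and> i \<in> e. \<Prod>w\<in>e - {i}. x w) = 0 * x i ^ (3 - 1)" for i
    by simp
  moreover have "x v \<noteq> 0"
    unfolding x_def by simp
  ultimately show ?thesis
    unfolding tensor_eigenvalue_def adjacency_tensor_sum[OF assms(1)] using assms(2) by blast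
qed

theorem theorem3p3:
  fixes H :: "'a hypergraph" and n l :: nat
  assumes "n \<ge> 3" and "l \<ge> 5"
    and "k_graph 3 H" and "linear_hypergraph H" and "connected_hypergraph H"
    and "card (verts H) = n"
    and "berge_free (cycle_graph l) H"
  shows "spectral_radius 3 H \<le> sqrt ((6 * real l - 13) * (real n - 1) / 4)"
  unfolding spectral_radius_def tensor_spectral_radius_def
proof (rule cSup_least)
  have "verts H \<noteq> {}"
    using assms(1,6) by auto
  then show "{cmod \<mu> | \<mu>. tensor_eigenvalue 3 (verts H) (adjacency_tensor 3 H) \<mu>} \<noteq> {}"
    using tensor_eigenvalue_0[OF assms(3)] by blast
next
  fix r assume "r \<in> {cmod \<mu> | \<mu>. tensor_eigenvalue 3 (verts H) (adjacency_tensor 3 H) \<mu>}"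
  then obtain \<mu> where \<mu>: "r = cmod \<mu>" "tensor_eigenvalue 3 (verts H) (adjacency_tensor 3 H) \<mu>"
    by blast
  obtain u where u: "u \<in> verts H"
      "2 * r\<^sup>2 \<le> real (\<Sum>v | adjacent H u v. card {e\<in>edges H. v \<in> e})"
    using eigenvalue_le_link_degree_sum[OF assms(3,4) \<mu>(2)] \<mu>(1) by blast
  note u(2)
  also have "real (\<Sum>v | adjacent H u v. card {e\<in>edges H. v \<in> e}) \<le> real ((3 * l - 7) * (n - 1))"
    using link_degree_sum_le[OF assms(3,4,7,2) u(1)] assms(6) by (intro of_nat_mono) simp
  \<comment> \<open>The truncated subtractions are genuine since \<open>7 \<le> 3 * l\<close> and
    \<open>1 \<le> n\<close>.\<close>
  also have "\<dots> = (3 * real l - 7) * (real n - 1)"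
    using assms(1,2) by (simp add: of_nat_diff)
  \<comment> \<open>The combinatorial bound is stronger by 1/2 in this coefficient; halving then
    gives \<open>(6 * real l - 13) / 4\<close>.\<close>
  also have "\<dots> \<le> (3 * real l - 13 / 2) * (real n - 1)"
    using assms(1) by (intro mult_right_mono) auto
  finally have "r\<^sup>2 \<le> (6 * real l - 13) * (real n - 1) / 4"
    by (simp add: field_simps)
  then show "r \<le> sqrt ((6 * real l - 13) * (real n - 1) / 4)"
    by (rule real_le_rsqrt)
qed

end
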